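(* Let $\|\cdot\|$ be a matrix norm on $\mathbb{R}^{3\times 3}$. There is a constant $C$ (independent of $\mathbf A$ and of the unit roundoff $\epsilon$) such that for every $\mathbf A\in\mathbb{R}^{3\times 3}$ the value $\mathrm{fl}(J_2)$ computed in floating-point arithmetic by Algorithm J2 (given in the context) with input $\mathbf A$ satisfies $$|\mathrm{fl}(J_2)-J_2(\mathbf A)|\le C\,\|\mathrm{dev}(\mathbf A)\|^2\,\epsilon+\mathcal O(\epsilon^2).$$
   Context: For $\mathbf A\in\mathbb{R}^{3\times3}$ (entries $A_{ij}$, $i,j\in\{0,1,2\}$), $\mathrm{dev}(\mathbf A)=\mathbf A-\tfrac13\mathrm{tr}(\mathbf A)\mathbf I$ and $J_2(\mathbf A)=\tfrac12\mathrm{tr}(\mathrm{dev}(\mathbf A)^2)$. Floating-point model: each elementary operation $\mathrm{op}\in\{+,-,*,/\}$ is computed with $\mathrm{fl}(x\,\mathrm{op}\,y)=(x\,\mathrm{op}\,y)(1+\delta)$, where $|\delta|\le\epsilon$ and $\delta$ may differ from operation to operation; $\epsilon$ is the unit roundoff (no overflow or underflow). The entries of the input matrix are taken as exact. For an algorithm, $\mathrm{fl}(\cdot)$ denotes the result when every operation is so rounded. Algorithm J2 (sums evaluated left to right; the factor $\tfrac16$ is applied as one division by 6): 1. $d_0=A_{00}-A_{11}$, $d_1=A_{00}-A_{22}$, $d_2=A_{11}-A_{22}$; 2. $\mathrm{offdiag}=A_{01}A_{10}+A_{02}A_{20}+A_{12}A_{21}$; 3. $\mathrm{diag}=\tfrac16(d_0^2+d_1^2+d_2^2)$;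 4. return $\mathrm{diag}+\mathrm{offdiag}$. $C$ denotes a moderate absolute constant (it may depend on the choice of norm). $\mathcal O(\epsilon^2)$ is understood as $\epsilon\to0$ for fixed $\mathbf A$: a quantity bounded by $K\epsilon^2$ for all sufficiently small $\epsilon$, with $K$ independent of $\epsilon$ and of the individual rounding errors (but possibly depending on $\mathbf A$). *)

theory Defs
  imports "HOL-Analysis.Analysis" "HOL-Library.Monad_Syntax"
begin

definition is_norm :: "('a::real_vector \<Rightarrow> real) \<Rightarrow> bool" where
  "is_norm N \<longleftrightarrow>
     (\<forall>x. N x = 0 \<longleftrightarrow> x = 0) \<and>
     (\<forall>a x. N (a *\<^sub>R x) = \<bar>a\<bar> * N x) \<and>
     (\<forall>x y. N (x + y) \<le> N x + N y)"

definition dev :: "real^3^3 \<Rightarrow> real^3^3" where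
  "dev A = A - (1/3 * trace A) *\<^sub>R mat 1"

definition J2 :: "real^3^3 \<Rightarrow> real" where
  "J2 A = 1/2 * trace (dev A ** dev A)"

text \<open>
  The set of all values that rounding the exact result \<open>x\<close> of one elementary operation
  may produce when the unit roundoff is \<open>\<epsilon>\<close>. Every use chooses its own \<open>\<delta>\<close>.
\<close>

definition fl :: "real \<Rightarrow> real \<Rightarrow> real set" where
  "fl \<epsilon> x = {x * (1 + \<delta>) | \<delta>. \<bar>\<delta>\<bar> \<le> \<epsilon>}"

text \<open>
  All possible outputs of the algorithm, in the set monad: one line per rounded operation.
  The type \<open>3\<close> is the integers modulo 3, so \<open>0\<close>, \<open>1\<close>, \<open>2\<close> are its three distinct indices
  (and \<open>0\<close> is the index that the library's lemmas call \<open>3\<close>).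
\<close>

definition fl_J2 :: "real \<Rightarrow> real^3^3 \<Rightarrow> real set" where
  "fl_J2 \<epsilon> A = do {
     d0 \<leftarrow> fl \<epsilon> (A$0$0 - A$1$1);
     d1 \<leftarrow> fl \<epsilon> (A$0$0 - A$2$2);
     d2 \<leftarrow> fl \<epsilon> (A$1$1 - A$2$2);
     p0 \<leftarrow> fl \<epsilon> (A$0$1 * A$1$0);
     p1 \<leftarrow> fl \<epsilon> (A$0$2 * A$2$0);
     p2 \<leftarrow> fl \<epsilon> (A$1$2 * A$2$1);
     p01 \<leftarrow> fl \<epsilon> (p0 + p1);
     offdiag \<leftarrow> fl \<epsilon> (p01 + p2);
     q0 \<leftarrow> fl \<epsilon> (d0 * d0);
     q1 \<leftarrow> fl \<epsilon> (d1 * d1);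
     q2 \<leftarrow> fl \<epsilon> (d2 * d2);
     q01 \<leftarrow> fl \<epsilon> (q0 + q1);
     q012 \<leftarrow> fl \<epsilon> (q01 + q2);
     diag \<leftarrow> fl \<epsilon> (q012 / 6);
     fl \<epsilon> (diag + offdiag)
   }"

end

theory Submission
  imports Defs
begin

text \<open>
  The algorithm only uses off-diagonal entries and differences of diagonal entries of the input,
  and these are the same for \<open>A\<close> and \<open>dev A\<close>. Hence every intermediate quantity
  that it adds up is quadratic in \<open>dev A\<close>, and a forward error analysis that carries along the sum
  of the absolute values of all summands bounds the error by \<open>\<parallel>dev A\<parallel>\<^sup>2 * \<epsilon>\<close>,
  without any second-order term once \<open>\<epsilon> \<le> 1\<close>.
\<close>

lemma is_norm_zero_iff: "is_norm N \<Longrightarrow> N x = 0 \<longleftrightarrow> x = 0"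
  by (simp add: is_norm_def)

lemma is_norm_scaleR: "is_norm N \<Longrightarrow> N (a *\<^sub>R x) = \<bar>a\<bar> * N x"
  by (simp add: is_norm_def)

lemma is_norm_triangle: "is_norm N \<Longrightarrow> N (x + y) \<le> N x + N y"
  unfolding is_norm_def by blast

lemma is_norm_nonneg:
  assumes "is_norm N"
  shows "0 \<le> N x"
proof -
  have "N (x + (-1) *\<^sub>R x) = 0"
    using is_norm_zero_iff[OF assms] by simp
  moreover have "N (x + (-1) *\<^sub>R x) \<le> N x + N ((-1) *\<^sub>R x)"
    by (rule is_norm_triangle[OF assms])
  ultimately show ?thesis
    using is_norm_scaleR[OF assms, of "-1" x] by simp
qed

lemma is_norm_convex_on:
  assumes "is_norm N"
  shows "convex_on UNIV N"
proof (rule convex_onI)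
  fix t :: real and x y
  assume "0 < t" "t < 1"
  moreover have "N ((1 - t) *\<^sub>R x + t *\<^sub>R y) \<le> N ((1 - t) *\<^sub>R x) + N (t *\<^sub>R y)"
    by (rule is_norm_triangle[OF assms])
  ultimately show "N ((1 - t) *\<^sub>R x + t *\<^sub>R y) \<le> (1 - t) * N x + t * N y"
    by (simp add: is_norm_scaleR[OF assms])
qed auto

text \<open>A convex function on a Euclidean space is continuous, so \<open>N\<close> attains a
  minimum \<open>N u\<close> on the compact unit sphere. Definiteness makes it positive, and
  homogeneity carries the bound to all vectors with \<open>c = 1 / N u\<close>.\<close>

lemma is_norm_ge_norm:
  fixes N :: "'a::euclidean_space \<Rightarrow> real"
  assumes "is_norm N"
  obtains c where "0 < c" "\<And>x. norm x \<le> c * N x"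
proof -
  have "continuous_on (sphere 0 1) N"
    using convex_on_continuous[OF open_UNIV is_norm_convex_on[OF assms]]
    by (rule continuous_on_subset) simp
  then obtain u :: 'a where u: "u \<in> sphere 0 1" "\<forall>y \<in> sphere 0 1. N u \<le> N y"
    using continuous_attains_inf[of "sphere (0::'a) 1" N] by auto
  have "N u \<noteq> 0" using u(1) is_norm_zero_iff[OF assms, of u] by auto
  then have pos: "0 < N u" using is_norm_nonneg[OF assms, of u] by simp
  show thesis
  proof
    show "0 < 1 / N u" using pos by simp
    fix x :: 'a
    show "norm x \<le> 1 / N u * N x"
    proof (cases "x = 0")
      case True
      then show ?thesis using is_norm_nonneg[OF assms, of x] pos by simp
    next
      case False
      have "N u \<le> N (inverse (norm x) *\<^sub>R x)"
        using u(2) False by simp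
      also have "\<dots> = N x / norm x"
        by (simp add: is_norm_scaleR[OF assms] divide_inverse mult.commute)
      finally show ?thesis using False pos by (simp add: field_simps)
    qed
  qed
qed

text \<open>
  \<open>S\<close> is a bound for \<open>x\<close> that, unlike \<open>\<bar>x\<bar>\<close>, is not affected by cancellation in sums.
\<close>

definition approx :: "real \<Rightarrow> real \<Rightarrow> real \<Rightarrow> real \<Rightarrow> real \<Rightarrow> bool" where
  "approx \<epsilon> c S x r \<longleftrightarrow> \<bar>x\<bar> \<le> S \<and> \<bar>r - x\<bar> \<le> c * \<epsilon> * S"

lemma approx_exact: "approx \<epsilon> 0 \<bar>x\<bar> x x"
  by (simp add: approx_def)

lemma approx_mono:
  assumes "approx \<epsilon> c S x r" "c \<le> c'" "0 \<le> \<epsilon>"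
  shows "approx \<epsilon> c' S x r"
proof -
  have "c * \<epsilon> * S \<le> c' * \<epsilon> * S"
    using assms by (intro mult_right_mono) (auto simp: approx_def)
  then show ?thesis using assms by (simp add: approx_def)
qed

lemma approx_bound:
  assumes "approx \<epsilon> c S x r" "0 \<le> c" "0 \<le> \<epsilon>" "\<epsilon> \<le> 1"
  shows "\<bar>r\<bar> \<le> (1 + c) * S"
proof -
  have S: "0 \<le> S" using assms(1) by (auto simp: approx_def)
  have "c * \<epsilon> \<le> c" using assms(2,4) by (simp add: mult_left_le)
  then have "c * \<epsilon> * S \<le> c * S" using S by (rule mult_right_mono)
  moreover have "\<bar>r\<bar> \<le> \<bar>x\<bar> + \<bar>r - x\<bar>" by simp
  ultimately have "\<bar>r\<bar> \<le> S + c * S"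
    using assms(1) unfolding approx_def by linarith
  then show ?thesis by (simp add: algebra_simps)
qed

text \<open>Rounding adds at most \<open>\<bar>r\<bar> * \<epsilon>\<close>, and
  \<open>\<bar>r\<bar>\<close> is at most \<open>(1 + c) * S\<close> because
  \<open>\<epsilon> \<le> 1\<close>. This use of \<open>\<epsilon> \<le> 1\<close> absorbs the
  higher powers of the roundoff into the constant, which grows to
  \<open>c + (1 + c)\<close>.\<close>

lemma approx_fl:
  assumes "approx \<epsilon> c S x r" "r' \<in> fl \<epsilon> r" "0 \<le> c" "0 \<le> \<epsilon>" "\<epsilon> \<le> 1"
  shows "approx \<epsilon> (2 * c + 1) S x r'"
proof -
  obtain d where d: "r' = r * (1 + d)" "\<bar>d\<bar> \<le> \<epsilon>"
    using assms(2) by (auto simp: fl_def)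
  have "\<bar>r * d\<bar> \<le> (1 + c) * S * \<epsilon>"
    unfolding abs_mult using approx_bound[OF assms(1,3-5)] d(2)
    by (intro mult_mono) auto
  moreover have "\<bar>r' - x\<bar> \<le> \<bar>r - x\<bar> + \<bar>r * d\<bar>"
    unfolding d(1) by (simp add: algebra_simps)
  ultimately show ?thesis
    using assms(1) by (simp add: approx_def algebra_simps)
qed

lemma approx_add:
  assumes "approx \<epsilon> c S x r" "approx \<epsilon> c T y s"
  shows "approx \<epsilon> c (S + T) (x + y) (r + s)"
  using assms by (auto simp: approx_def algebra_simps)

lemma approx_mult:
  assumes "approx \<epsilon> c S x r" "approx \<epsilon> c T y s" "0 \<le> c" "0 \<le> \<epsilon>" "\<epsilon> \<le> 1"
  shows "approx \<epsilon> (2 * c + c\<^sup>2) (S * T) (x * y) (r * s)"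
proof -
  \<comment> \<open>The product error is split as r(s - y) + (r - x)y. The two parts contribute (1 +
    c)c and c to the new constant.\<close>
  have "\<bar>r * (s - y)\<bar> \<le> (1 + c) * S * (c * \<epsilon> * T)"
    unfolding abs_mult using approx_bound[OF assms(1,3-5)] assms(2)
    by (intro mult_mono) (auto simp: approx_def)
  moreover have "\<bar>(r - x) * y\<bar> \<le> c * \<epsilon> * S * T"
    unfolding abs_mult using assms(1,2) by (intro mult_mono) (auto simp: approx_def)
  moreover have "r * s - x * y = r * (s - y) + (r - x) * y"
    by (simp add: algebra_simps)
  ultimately have "\<bar>r * s - x * y\<bar> \<le> (1 + c) * S * (c * \<epsilon> * T) + c * \<epsilon> * S * T"
    by linarith
  moreover have "\<bar>x * y\<bar> \<le> S * T"
    unfolding abs_mult using assms(1,2) by (intro mult_mono) (auto simp: approx_def)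
  ultimately show ?thesis
    by (simp add: approx_def algebra_simps power2_eq_square)
qed

lemma approx_divide:
  assumes "approx \<epsilon> c S x r" "0 < k"
  shows "approx \<epsilon> c (S / k) (x / k) (r / k)"
proof -
  have "\<bar>r / k - x / k\<bar> = \<bar>r - x\<bar> / k"
    using assms(2) by (simp flip: diff_divide_distrib)
  then show ?thesis
    using assms by (auto simp: approx_def intro: divide_right_mono)
qed

text \<open>Needed because \<open>sum_3\<close> produces the index \<open>3\<close>, whereas the
  algorithm is written with \<open>0\<close>.\<close>

lemma three_eq_zero: "(3::3) = 0"
  by simp

text \<open>The diagonal entries s_i of \<open>dev A\<close> sum to 0, so the sum of the squares
  (s_i - s_j)^2 over i < j is three times the sum of the s_i^2. Half the trace therefore gives the
  factor 1/6, and s_i - s_j is the difference of the diagonal entries of \<open>A\<close>. Each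
  off-diagonal product occurs twice in the trace.\<close>

lemma J2_eq:
  "J2 A = ((A$0$0 - A$1$1) * (A$0$0 - A$1$1) + (A$0$0 - A$2$2) * (A$0$0 - A$2$2)
             + (A$1$1 - A$2$2) * (A$1$1 - A$2$2)) / 6
          + (A$0$1 * A$1$0 + A$0$2 * A$2$0 + A$1$2 * A$2$1)"
  unfolding J2_def dev_def trace_def matrix_matrix_mult_def sum_3 three_eq_zero
  by (simp add: mat_def sum_3 three_eq_zero field_simps)

text \<open>The formula of \<open>J2_eq\<close> with every summand replaced by its absolute value:
  the \<open>S\<close> that the rules for \<open>approx\<close> accumulate along the
  algorithm.\<close>

definition J2_magnitude :: "real^3^3 \<Rightarrow> real" where
  "J2_magnitude A =
     (\<bar>A$0$0 - A$1$1\<bar> * \<bar>A$0$0 - A$1$1\<bar> + \<bar>A$0$0 - A$2$2\<bar> * \<bar>A$0$0 - A$2$2\<bar>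
        + \<bar>A$1$1 - A$2$2\<bar> * \<bar>A$1$1 - A$2$2\<bar>) / 6
     + (\<bar>A$0$1 * A$1$0\<bar> + \<bar>A$0$2 * A$2$0\<bar> + \<bar>A$1$2 * A$2$1\<bar>)"

text \<open>Each rounding turns the constant c into 2c + 1. On the longest path this gives 1 for a
  difference, 7 for its rounded square, 15 and 31 for the two sums, 63 for the division and 127 for
  the last sum.\<close>

lemma fl_J2_approx:
  assumes "r \<in> fl_J2 \<epsilon> A" "0 \<le> \<epsilon>" "\<epsilon> \<le> 1"
  shows "approx \<epsilon> 127 (J2_magnitude A) (J2 A) r"
proof -
  obtain d0 d1 d2 p0 p1 p2 p01 offd q0 q1 q2 q01 q012 dg where
    d: "d0 \<in> fl \<epsilon> (A$0$0 - A$1$1)" "d1 \<in> fl \<epsilon> (A$0$0 - A$2$2)" "d2 \<in> fl \<epsilon> (A$1$1 - A$2$2)"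
    and p: "p0 \<in> fl \<epsilon> (A$0$1 * A$1$0)" "p1 \<in> fl \<epsilon> (A$0$2 * A$2$0)" "p2 \<in> fl \<epsilon> (A$1$2 * A$2$1)"
    and p01: "p01 \<in> fl \<epsilon> (p0 + p1)" and offd: "offd \<in> fl \<epsilon> (p01 + p2)"
    and q: "q0 \<in> fl \<epsilon> (d0 * d0)" "q1 \<in> fl \<epsilon> (d1 * d1)" "q2 \<in> fl \<epsilon> (d2 * d2)"
    and q01: "q01 \<in> fl \<epsilon> (q0 + q1)" and q012: "q012 \<in> fl \<epsilon> (q01 + q2)"
    and dg: "dg \<in> fl \<epsilon> (q012 / 6)" and r: "r \<in> fl \<epsilon> (dg + offd)"
    using assms(1) unfolding fl_J2_def by auto
  note fl = approx_fl[OF _ _ _ assms(2,3)] and mono = approx_mono[OF _ _ assms(2)]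
  have rounded: "approx \<epsilon> 1 \<bar>x\<bar> x y" if "y \<in> fl \<epsilon> x" for x y
    using fl[OF approx_exact that] by simp
  have square: "approx \<epsilon> 7 (\<bar>x\<bar> * \<bar>x\<bar>) (x * x) z" if "y \<in> fl \<epsilon> x" "z \<in> fl \<epsilon> (y * y)" for x y z
    \<comment> \<open>The exact product of two factors with constant 1 has constant 2 + 1 = 3, and
      rounding makes it 7.\<close>
    using fl[OF approx_mult[OF rounded[OF that(1)] rounded[OF that(1)] _ assms(2,3)] that(2)]
    by simp
  have "approx \<epsilon> 3 (\<bar>A$0$1 * A$1$0\<bar> + \<bar>A$0$2 * A$2$0\<bar>) (A$0$1 * A$1$0 + A$0$2 * A$2$0) p01"
    using fl[OF approx_add[OF rounded[OF p(1)] rounded[OF p(2)]] p01] by simp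
  \<comment> \<open>\<open>approx_add\<close> wants one constant for both summands, so the less
    rounded summand is weakened by \<open>mono\<close>, here from 1 to 3.\<close>
  from fl[OF approx_add[OF this mono[OF rounded[OF p(3)]]] offd]
  have off: "approx \<epsilon> 7 (\<bar>A$0$1 * A$1$0\<bar> + \<bar>A$0$2 * A$2$0\<bar> + \<bar>A$1$2 * A$2$1\<bar>)
      (A$0$1 * A$1$0 + A$0$2 * A$2$0 + A$1$2 * A$2$1) offd"
    by simp
  note sq = square[OF d(1) q(1)] square[OF d(2) q(2)] square[OF d(3) q(3)]
  have "approx \<epsilon> 15 (\<bar>A$0$0 - A$1$1\<bar> * \<bar>A$0$0 - A$1$1\<bar> + \<bar>A$0$0 - A$2$2\<bar> * \<bar>A$0$0 - A$2$2\<bar>)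
      ((A$0$0 - A$1$1) * (A$0$0 - A$1$1) + (A$0$0 - A$2$2) * (A$0$0 - A$2$2)) q01"
    using fl[OF approx_add[OF sq(1,2)] q01] by simp
  from fl[OF approx_add[OF this mono[OF sq(3)]] q012]
  have "approx \<epsilon> 31 (\<bar>A$0$0 - A$1$1\<bar> * \<bar>A$0$0 - A$1$1\<bar> + \<bar>A$0$0 - A$2$2\<bar> * \<bar>A$0$0 - A$2$2\<bar>
        + \<bar>A$1$1 - A$2$2\<bar> * \<bar>A$1$1 - A$2$2\<bar>)
      ((A$0$0 - A$1$1) * (A$0$0 - A$1$1) + (A$0$0 - A$2$2) * (A$0$0 - A$2$2)
        + (A$1$1 - A$2$2) * (A$1$1 - A$2$2)) q012"
    by simp
  from fl[OF approx_divide[OF this, of 6] dg]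
  have "approx \<epsilon> 63 ((\<bar>A$0$0 - A$1$1\<bar> * \<bar>A$0$0 - A$1$1\<bar> + \<bar>A$0$0 - A$2$2\<bar> * \<bar>A$0$0 - A$2$2\<bar>
        + \<bar>A$1$1 - A$2$2\<bar> * \<bar>A$1$1 - A$2$2\<bar>) / 6)
      (((A$0$0 - A$1$1) * (A$0$0 - A$1$1) + (A$0$0 - A$2$2) * (A$0$0 - A$2$2)
        + (A$1$1 - A$2$2) * (A$1$1 - A$2$2)) / 6) dg"
    by simp
  from fl[OF approx_add[OF this mono[OF off]] r]
  show ?thesis
    unfolding J2_magnitude_def J2_eq by simp
qed

lemma abs_entry_le_norm:
  fixes A :: "real^'n^'m"
  shows "\<bar>A$i$j\<bar> \<le> norm A"
  using component_le_norm_cart[of "A$i" j] Finite_Cartesian_Product.norm_nth_le[of A i] by linarith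

text \<open>Lets the bound in terms of \<open>norm A\<close> be applied to \<open>dev A\<close>
  instead.\<close>

lemma J2_magnitude_dev: "J2_magnitude (dev A) = J2_magnitude A"
  by (simp add: J2_magnitude_def dev_def mat_def)

text \<open>The three squares contribute 3 * 4 / 6 = 2 and the three products contribute 3.\<close>

lemma J2_magnitude_le: "J2_magnitude A \<le> 5 * (norm A)\<^sup>2"
proof -
  have diff: "\<bar>A$i$i - A$j$j\<bar> * \<bar>A$i$i - A$j$j\<bar> \<le> 4 * (norm A)\<^sup>2" for i j
  proof -
    have "\<bar>A$i$i - A$j$j\<bar> * \<bar>A$i$i - A$j$j\<bar> \<le> (2 * norm A) * (2 * norm A)"
      using abs_entry_le_norm[of A i i] abs_entry_le_norm[of A j j] by (intro mult_mono) auto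
    then show ?thesis by (simp add: power2_eq_square)
  qed
  have prod: "\<bar>A$i$j * A$j$i\<bar> \<le> (norm A)\<^sup>2" for i j
    unfolding abs_mult power2_eq_square by (intro mult_mono abs_entry_le_norm) auto
  have "(a + b + c) / 6 + (d + e + f) \<le> 5 * s"
    if "a \<le> 4 * s" "b \<le> 4 * s" "c \<le> 4 * s" "d \<le> s" "e \<le> s" "f \<le> s" for a b c d e f s :: real
    using that by (simp add: field_simps)
  from this[OF diff diff diff prod prod prod] show ?thesis
    unfolding J2_magnitude_def .
qed

theorem theorem3:
  fixes N :: "real^3^3 \<Rightarrow> real"
  assumes "is_norm N"
  shows "\<exists>C::real. \<forall>A::real^3^3. \<exists>K::real. \<forall>\<^sub>F \<epsilon> in at_right 0.
           \<forall>r \<in> fl_J2 \<epsilon> A. \<bar>r - J2 A\<bar> \<le> C * (N (dev A))\<^sup>2 * \<epsilon> + K * \<epsilon>\<^sup>2"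
proof -
  obtain c where c: "0 < c" "\<And>x. norm x \<le> c * N x"
    using is_norm_ge_norm[OF assms] by blast
  \<comment> \<open>The constant is 127 * 5 = 635, times \<open>c\<^sup>2\<close> for passing from
    \<open>norm\<close> to \<open>N\<close>. The witness for \<open>K\<close> is 0.\<close>
  have bound: "\<bar>r - J2 A\<bar> \<le> (635 * c\<^sup>2) * (N (dev A))\<^sup>2 * \<epsilon> + 0 * \<epsilon>\<^sup>2"
    if r: "r \<in> fl_J2 \<epsilon> A" and \<epsilon>: "0 < \<epsilon>" "\<epsilon> < 1" for \<epsilon> r A
  proof -
    have "(norm (dev A))\<^sup>2 \<le> (c * N (dev A))\<^sup>2"
      using c(2) by (intro power_mono) auto
    then have "J2_magnitude A \<le> 5 * (c\<^sup>2 * (N (dev A))\<^sup>2)"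
      using J2_magnitude_le[of "dev A"] unfolding J2_magnitude_dev power_mult_distrib by linarith
    then have "127 * \<epsilon> * J2_magnitude A \<le> 127 * \<epsilon> * (5 * (c\<^sup>2 * (N (dev A))\<^sup>2))"
      using \<epsilon> by (intro mult_left_mono) auto
    moreover have "\<bar>r - J2 A\<bar> \<le> 127 * \<epsilon> * J2_magnitude A"
      using fl_J2_approx[OF r] \<epsilon> by (simp add: approx_def)
    ultimately show ?thesis by (simp add: mult_ac)
  qed
  have "\<forall>\<^sub>F \<epsilon> in at_right (0::real). 0 < \<epsilon> \<and> \<epsilon> < 1"
    using eventually_at_right_less[of "0::real"] eventually_at_right_field[of _ "0::real"]
    by (auto intro!: exI[of _ 1])
  then have "\<forall>\<^sub>F \<epsilon> in at_right 0. \<forall>r \<in> fl_J2 \<epsilon> A.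
      \<bar>r - J2 A\<bar> \<le> (635 * c\<^sup>2) * (N (dev A))\<^sup>2 * \<epsilon> + 0 * \<epsilon>\<^sup>2" for A
    by eventually_elim (use bound in blast)
  then show ?thesis by blast
qed

end
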